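(* The map $z$ from the set of Gauss words to the abelian group $Z$ is a homotopy invariant of Gauss words; that is, if two Gauss words $w_1$ and $w_2$ are homotopic, then $z(w_1)=z(w_2)$ in $Z$.
   Context: **Gauss words.** An alphabet is a finite set, whose elements are called letters. A word on an alphabet $\mathcal{A}$ is a finite (possibly empty) sequence of letters of $\mathcal{A}$; $\emptyset$ denotes the empty word. A Gauss word on $\mathcal{A}$ is a word in which every letter of $\mathcal{A}$ appears exactly twice (so $\mathcal{A}$ is the set of letters appearing in the word). Gauss words $u$ on $\mathcal{A}$ and $v$ on $\mathcal{B}$ are isomorphic if there is a bijection $f:\mathcal{A}\to\mathcal{B}$ such that $f$ applied letterwise to $u$ gives $v$. **Homotopy of Gauss words.** The homotopy moves on Gauss words are the following (each may be applied in either direction), where $A,B,C$ are individual (distinct) letters and $t,x,y,z$ are arbitrary, possibly empty, sequences of letters such that both sides are Gauss words: Shift: $AxAy \leftrightarrow xAyA$; H1: $xAAy \leftrightarrow xy$; H2: $xAByBAz \leftrightarrow xyz$; H3: $xAByACzBCt \leftrightarrow xBAyCAzCBt$. Two Gauss words are homotopic if one can be transformed into the other by a finite sequence of isomorphisms and homotopy moves. **Gauss phrases and unordered homotopy.** A Gauss phrase with $n$ components is a finite sequence of words $w_1|\dotso|w_n$ (components, possibly empty) whose concatenation $w_1\dotso w_n$ is a Gauss word. Two $n$-component Gauss phrases $u_1|\dotso|u_n$ and $v_1|\dotso|v_n$ are isomorphic if there is a bijection of their alphabets which applied letterwise sends $u_i$ to $v_i$ for all $i$. The moves H1, H2, H3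 on Gauss phrases are the following (each may be applied in either direction), where $A,B,C$ are individual (distinct) letters and $t,x,y,z$ are arbitrary, possibly empty, sequences of letters which may also contain occurrences of the separator $|$, such that both sides are Gauss phrases: H1: $xAAy \leftrightarrow xy$; H2: $xAByBAz \leftrightarrow xyz$; H3: $xAByACzBCt \leftrightarrow xBAyCAzCBt$; the two-letter subwords $AA$, $AB$, $BA$, $AC$, $CA$, $BC$, $CB$ explicitly displayed in the moves must not be broken by a separator. A shift move on the $i$th component replaces a component of the form $Ax$ ($A$ a letter, $x$ a letter sequence) by $xA$, leaving the other components unchanged. Unordered homotopy of Gauss phrases is the equivalence relation generated by isomorphisms, the moves H1, H2, H3, shift moves on any component, and permutations of the components. **The map $z$.** Let $\mathcal{GP}(2)$ be the set of equivalence classes of $2$-component Gauss phrases under unordered homotopy, let $G$ be the free abelian group generated by $\mathcal{GP}(2)$, let $Z=G/2G$, and let $\theta:G\to Z$ be the natural homomorphism. For a Gauss word $w$ and a letter $A$ in $w$, write $w=xAyAz$ (with $x,y,z$ sequences of letters) and let $p(w,A)$ be the Gauss phrase $y|xz$; let $u(w,A)\in\mathcal{GP}(2)$ be the unordered homotopy class of $p(w,A)$, and let $t(w)\in\mathcal{GP}(2)$ be the unordered homotopy class of $\emptyset|w$. Define $$g(w)=\sum_{A\in w}\bigl(u(w,A)-t(w)\bigr)\in G,\qquad z(w)=\theta(g(w))\in Z,$$ where the sum is over all letters $A$ in the alphabet of $w$ (each letter counted once). *)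

theory Defs
  imports "HOL-Algebra.Algebra" "HOL-Library.Infinite_Typeclass"
begin

text \<open>
  Letters are the elements of a type \<^typ>\<open>'a\<close>; the alphabet of a word \<^term>\<open>w\<close> is the finite
  set \<^term>\<open>set w\<close>. The type is meant to be infinite, so that it contains a copy of every
  alphabet and never runs out of fresh letters.
\<close>

section \<open>Gauss words and their homotopy\<close>

definition gauss_word :: "'a list \<Rightarrow> bool" where
  "gauss_word w \<longleftrightarrow> (\<forall>A\<in>set w. count_list w A = 2)"

definition word_iso :: "'a list \<Rightarrow> 'a list \<Rightarrow> bool" where
  "word_iso u v \<longleftrightarrow> (\<exists>f. bij_betw f (set u) (set v) \<and> v = map f u)"

inductive word_move :: "'a list \<Rightarrow> 'a list \<Rightarrow> bool" where
  Shift: "word_move ([A] @ x @ [A] @ y) (x @ [A] @ y @ [A])"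
| H1: "word_move (x @ [A, A] @ y) (x @ y)"
| H2: "distinct [A, B] \<Longrightarrow> word_move (x @ [A, B] @ y @ [B, A] @ z) (x @ y @ z)"
| H3: "distinct [A, B, C] \<Longrightarrow>
    word_move (x @ [A, B] @ y @ [A, C] @ z @ [B, C] @ t)
              (x @ [B, A] @ y @ [C, A] @ z @ [C, B] @ t)"

definition word_step :: "'a list \<Rightarrow> 'a list \<Rightarrow> bool" where
  "word_step u v \<longleftrightarrow> gauss_word u \<and> gauss_word v \<and>
     (word_iso u v \<or> word_move u v \<or> word_move v u)"

definition homotopic_words :: "'a list \<Rightarrow> 'a list \<Rightarrow> bool" where
  "homotopic_words u v \<longleftrightarrow> gauss_word u \<and> gauss_word v \<and> word_step\<^sup>*\<^sup>* u v"


section \<open>Gauss phrases and their unordered homotopy\<close>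

text \<open>A phrase is the list of its components.\<close>

definition gauss_phrase :: "nat \<Rightarrow> 'a list list \<Rightarrow> bool" where
  "gauss_phrase n P \<longleftrightarrow> length P = n \<and> gauss_word (concat P)"

definition phrase_iso :: "'a list list \<Rightarrow> 'a list list \<Rightarrow> bool" where
  "phrase_iso P Q \<longleftrightarrow>
     (\<exists>f. bij_betw f (set (concat P)) (set (concat Q)) \<and> Q = map (map f) P)"

text \<open>
  The phrase \<open>w\<^sub>1|\<dots>|w\<^sub>n\<close> written out as a single sequence of symbols, where \<^term>\<open>Some A\<close> is
  the letter \<^term>\<open>A\<close> and \<^term>\<open>None\<close> is the separator. For a fixed number \<open>n \<ge> 1\<close> of components
  this loses no information.
\<close>

fun symbols :: "'a list list \<Rightarrow> 'a option list" where
  "symbols [] = []"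
| "symbols [w] = map Some w"
| "symbols (w # v # P) = map Some w @ [None] @ symbols (v # P)"

inductive symbol_move :: "'a option list \<Rightarrow> 'a option list \<Rightarrow> bool" where
  H1: "symbol_move (x @ [Some A, Some A] @ y) (x @ y)"
| H2: "distinct [A, B] \<Longrightarrow>
    symbol_move (x @ [Some A, Some B] @ y @ [Some B, Some A] @ z) (x @ y @ z)"
| H3: "distinct [A, B, C] \<Longrightarrow>
    symbol_move (x @ [Some A, Some B] @ y @ [Some A, Some C] @ z @ [Some B, Some C] @ t)
                (x @ [Some B, Some A] @ y @ [Some C, Some A] @ z @ [Some C, Some B] @ t)"

inductive phrase_shift :: "'a list list \<Rightarrow> 'a list list \<Rightarrow> bool" where
  "phrase_shift (P @ [[A] @ x] @ Q) (P @ [x @ [A]] @ Q)"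

text \<open>Permuting the components amounts to keeping the multiset of components.\<close>

definition phrase_step :: "nat \<Rightarrow> 'a list list \<Rightarrow> 'a list list \<Rightarrow> bool" where
  "phrase_step n P Q \<longleftrightarrow> gauss_phrase n P \<and> gauss_phrase n Q \<and>
     (phrase_iso P Q \<or> symbol_move (symbols P) (symbols Q) \<or> phrase_shift P Q \<or> mset P = mset Q)"

definition unordered_homotopy :: "nat \<Rightarrow> ('a list list \<times> 'a list list) set" where
  "unordered_homotopy n =
     {(P, Q). gauss_phrase n P \<and> gauss_phrase n Q \<and> equivclp (phrase_step n) P Q}"

definition GP :: "nat \<Rightarrow> 'a list list set set" where
  "GP n = {P. gauss_phrase n P} // unordered_homotopy n"

definition GP_class :: "nat \<Rightarrow> 'a list list \<Rightarrow> 'a list list set" where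
  "GP_class n P = unordered_homotopy n `` {P}"

lemma equiv_unordered_homotopy: "equiv {P. gauss_phrase n P} (unordered_homotopy n)"
  by (rule equivI)
     (auto simp: unordered_homotopy_def refl_on_def sym_def trans_def
       intro: equivclp_sym equivclp_trans)


section \<open>The map z\<close>

definition G_grp :: "('a list list set \<Rightarrow>\<^sub>0 int) monoid" where
  "G_grp = free_Abelian_group (GP 2)"

definition twoG :: "('a list list set \<Rightarrow>\<^sub>0 int) set" where
  "twoG = (\<lambda>c. c \<otimes>\<^bsub>G_grp\<^esub> c) ` carrier G_grp"

definition Z_grp :: "('a list list set \<Rightarrow>\<^sub>0 int) set monoid" where
  "Z_grp = G_grp Mod twoG"

definition theta :: "('a list list set \<Rightarrow>\<^sub>0 int) \<Rightarrow> ('a list list set \<Rightarrow>\<^sub>0 int) set" where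
  "theta c = twoG #>\<^bsub>G_grp\<^esub> c"

definition p_phrase :: "'a list \<Rightarrow> 'a \<Rightarrow> 'a list list" where
  "p_phrase w A = (THE P. \<exists>x y z. w = x @ [A] @ y @ [A] @ z \<and> P = [y, x @ z])"

definition u_class :: "'a list \<Rightarrow> 'a \<Rightarrow> 'a list list set" where
  "u_class w A = GP_class 2 (p_phrase w A)"

definition t_class :: "'a list \<Rightarrow> 'a list list set" where
  "t_class w = GP_class 2 [[], w]"

text \<open>The group operation of \<^term>\<open>G_grp\<close> is addition in \<^typ>\<open>'a list list set \<Rightarrow>\<^sub>0 int\<close>.\<close>

definition g_map :: "'a list \<Rightarrow> ('a list list set \<Rightarrow>\<^sub>0 int)" where
  "g_map w = (\<Sum>A\<in>set w. frag_of (u_class w A) - frag_of (t_class w))"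

definition z_map :: "'a list \<Rightarrow> ('a list list set \<Rightarrow>\<^sub>0 int) set" where
  "z_map w = theta (g_map w)"


subsection \<open>Well-definedness\<close>

lemma first_occurrence_unique:
  "A \<notin> set x \<Longrightarrow> A \<notin> set x' \<Longrightarrow> x @ A # r = x' @ A # r' \<Longrightarrow> x = x' \<and> r = r'"
proof (induction x arbitrary: x')
  case Nil
  then show ?case by (cases x') auto
next
  case (Cons a x)
  then show ?case by (cases x') auto
qed

lemma gauss_word_mset_cong:
  assumes "mset u = mset v"
  shows "gauss_word u \<longleftrightarrow> gauss_word v"
proof -
  have "set u = set v" "count_list u = count_list v"
    using assms mset_eq_setD[OF assms] by (auto simp: fun_eq_iff simp flip: count_mset)
  then show ?thesis
    unfolding gauss_word_def by simp
qed

lemma p_phrase_eq: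
  assumes "gauss_word (x @ [A] @ y @ [A] @ z)"
  shows "p_phrase (x @ [A] @ y @ [A] @ z) A = [y, x @ z]"
proof -
  have fresh: "A \<notin> set x \<and> A \<notin> set y \<and> A \<notin> set z"
    if "gauss_word (x @ [A] @ y @ [A] @ z)" for x y z
    using that by (auto simp: gauss_word_def count_list_0_iff)
  have uniq: "x' = x \<and> y' = y \<and> z' = z"
    if eq: "x @ [A] @ y @ [A] @ z = x' @ [A] @ y' @ [A] @ z'" for x' y' z'
  proof -
    have f: "A \<notin> set x" "A \<notin> set y" "A \<notin> set x'" "A \<notin> set y'"
      using fresh[OF assms] fresh[OF assms[unfolded eq]] by blast+
    have "x = x' \<and> y @ A # z = y' @ A # z'"
      using f eq by (intro first_occurrence_unique) auto
    then show ?thesis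
      using first_occurrence_unique[OF f(2,4), of z z'] by blast
  qed
  show ?thesis
    unfolding p_phrase_def
  proof (rule the_equality)
    fix P
    assume "\<exists>x' y' z'. x @ [A] @ y @ [A] @ z = x' @ [A] @ y' @ [A] @ z' \<and> P = [y', x' @ z']"
    then show "P = [y, x @ z]"
      using uniq by metis
  qed blast
qed

lemma gauss_word_split:
  assumes "gauss_word w" "A \<in> set w"
  obtains x y z where "w = x @ [A] @ y @ [A] @ z"
proof -
  obtain x r where x: "w = x @ A # r" "A \<notin> set x"
    using assms(2) by (meson split_list_first)
  then have "count_list r A = 1"
    using assms by (auto simp: gauss_word_def count_list_0_iff)
  then have "A \<in> set r"
    by (metis count_list_0_iff zero_neq_one)
  then obtain y z where "r = y @ A # z"
    by (meson split_list)
  with x that show thesis by simp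
qed

lemma gauss_phrase_p:
  assumes "gauss_word w" "A \<in> set w"
  shows "gauss_phrase 2 (p_phrase w A)"
proof -
  obtain x y z where w: "w = x @ [A] @ y @ [A] @ z"
    using gauss_word_split[OF assms] .
  have "count_list (x @ y @ z) B = 2" if B: "B \<in> set (x @ y @ z)" for B
  proof -
    have "count_list w B = 2" "count_list w A = 2"
      using assms B unfolding gauss_word_def w by auto
    moreover have "B \<noteq> A"
      using B \<open>count_list w A = 2\<close> unfolding w by (auto simp: count_list_0_iff)
    ultimately show ?thesis
      unfolding w by simp
  qed
  then have "gauss_word (x @ y @ z)"
    unfolding gauss_word_def by blast
  moreover have "mset (y @ x @ z) = mset (x @ y @ z)"
    by simp
  ultimately have "gauss_word (y @ x @ z)"
    using gauss_word_mset_cong by blast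
  then show ?thesis
    using assms(1) unfolding w by (simp add: p_phrase_eq[simplified] gauss_phrase_def)
qed

lemma gauss_phrase_t: "gauss_word w \<Longrightarrow> gauss_phrase 2 [[], w]"
  by (simp add: gauss_phrase_def)

lemma GP_class_in_GP: "gauss_phrase n P \<Longrightarrow> GP_class n P \<in> GP n"
  by (auto simp: GP_def GP_class_def intro: quotientI)

lemma g_map_in_G: "gauss_word w \<Longrightarrow> g_map w \<in> carrier G_grp"
proof -
  assume w: "gauss_word w"
  have "Poly_Mapping.keys (frag_of (u_class w A) - frag_of (t_class w)) \<subseteq> GP 2" if "A \<in> set w" for A
    using keys_diff[of "frag_of (u_class w A)" "frag_of (t_class w)"]
      GP_class_in_GP[OF gauss_phrase_p[OF w that]] GP_class_in_GP[OF gauss_phrase_t[OF w]]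
    by (auto simp: u_class_def t_class_def)
  then have "Poly_Mapping.keys (g_map w) \<subseteq> GP 2"
    unfolding g_map_def by (intro order_trans[OF keys_sum] UN_least)
  then show ?thesis
    by (simp add: G_grp_def)
qed

lemma comm_group_G: "comm_group G_grp"
  unfolding G_grp_def by (rule abelian_free_Abelian_group)

lemma subgroup_twoG: "subgroup twoG G_grp"
proof -
  interpret comm_group G_grp by (rule comm_group_G)
  have "(\<lambda>c. c \<otimes>\<^bsub>G_grp\<^esub> c) \<in> hom G_grp G_grp"
    by (auto simp: hom_def m_ac)
  then interpret group_hom G_grp G_grp "\<lambda>c. c \<otimes>\<^bsub>G_grp\<^esub> c"
    by unfold_locales
  show ?thesis
    unfolding twoG_def by (rule img_is_subgroup)
qed

lemma comm_group_Z: "comm_group Z_grp"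
  unfolding Z_grp_def by (rule comm_group.abelian_FactGroup[OF comm_group_G subgroup_twoG])

lemma theta_hom: "theta \<in> hom G_grp Z_grp"
  using normal.r_coset_hom_Mod[OF comm_group.subgroup_imp_normal[OF comm_group_G subgroup_twoG]]
  unfolding Z_grp_def theta_def[abs_def] .

lemma z_map_in_Z: "gauss_word w \<Longrightarrow> z_map w \<in> carrier Z_grp"
  using theta_hom g_map_in_G by (auto simp: z_map_def hom_def)

end

theory Submission
  imports Defs
begin

text \<open>
  Isomorphic words have the same \<open>g\<close>, so it suffices to compare \<open>g\<close> before and after one move.
  The class \<open>t(w)\<close> never changes, since every
  move on \<open>w\<close> is also a move on the phrase \<open>\<emptyset>|w\<close>. A letter \<open>D\<close> that is not displayed in the move keeps
  its class \<open>u(w,D)\<close>, and the displayed letters contribute as follows.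

    \<^item> H1: the phrase of \<open>A\<close> is \<open>\<emptyset>|xy\<close>, so \<open>A\<close> contributes \<open>t(w) - t(w) = 0\<close>.
    \<^item> H2: the phrases of \<open>A\<close> and \<open>B\<close> are \<open>ByB|xz\<close> and \<open>y|xAAz\<close>. Both reduce to \<open>y|xz\<close>, so the two letters
      contribute twice the same element. This is the only place where \<open>g\<close> itself may change, and the
      reason for working modulo \<open>2G\<close>.
    \<^item> H3: each of \<open>A\<close>, \<open>B\<close>, \<open>C\<close> keeps its class. For \<open>A\<close> and \<open>C\<close> this is a shift and a renaming. For \<open>B\<close>
      the phrases are \<open>yACz|xACt\<close> and \<open>AyCAzC|xt\<close>, and both are homotopic to \<open>yz|xt\<close> provided that
      a pair of \<^emph>\<open>parallel\<close> subwords \<open>AB\<dots>AB\<close> may be deleted.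

  Deleting parallel subwords is not one of the moves, but it follows from them
  (lemma \<open>symbol_sim_H2_parallel\<close>) with the help of fresh letters; this is where an infinite supply
  of letters is used.

  For the letters \<open>D\<close> not displayed in the move, note that \<open>u(w,D)\<close> is unchanged when \<open>w\<close> is rotated
  (lemma \<open>u_class_rotate\<close>). Rotating \<open>w\<close> to \<open>DyDz\<close> turns the phrase of \<open>D\<close> into \<open>y|z\<close>, which is just the
  rest of the word with the second \<open>D\<close> read as a separator. A move on \<open>w\<close> thereby becomes a
  move on the phrase, except that rotation permutes its displayed subwords cyclically. For H2 this
  is harmless; for H3 it calls for the versions of that move with the three displayed subwords in
  another cyclic order, and these follow from H3 and the deletion of parallel subwords
  (lemmas \<open>symbol_sim_H3_231\<close> and \<open>symbol_sim_H3_312\<close>).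
\<close>

section \<open>Unordered homotopy of two-component phrases\<close>

definition phrase_sim :: "'a list list \<Rightarrow> 'a list list \<Rightarrow> bool" (infix "\<sim>\<^sub>p" 50) where
  "P \<sim>\<^sub>p Q \<longleftrightarrow> (P, Q) \<in> unordered_homotopy 2"

lemma phrase_sim_sym: "P \<sim>\<^sub>p Q \<Longrightarrow> Q \<sim>\<^sub>p P"
  unfolding phrase_sim_def using equiv_unordered_homotopy[of 2] by (meson equivE symE)

lemma phrase_sim_trans [trans]: "P \<sim>\<^sub>p Q \<Longrightarrow> Q \<sim>\<^sub>p R \<Longrightarrow> P \<sim>\<^sub>p R"
  unfolding phrase_sim_def using equiv_unordered_homotopy[of 2] by (meson equivE transE)

lemma phrase_sim_gauss: "P \<sim>\<^sub>p Q \<Longrightarrow> gauss_phrase 2 P \<and> gauss_phrase 2 Q"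
  by (simp add: phrase_sim_def unordered_homotopy_def)

lemma phrase_step_imp_sim: "phrase_step 2 P Q \<Longrightarrow> P \<sim>\<^sub>p Q"
  by (auto simp: phrase_sim_def unordered_homotopy_def phrase_step_def intro: r_into_equivclp)

lemma GP_class_eqI: "P \<sim>\<^sub>p Q \<Longrightarrow> GP_class 2 P = GP_class 2 Q"
  unfolding GP_class_def phrase_sim_def by (rule equiv_class_eq[OF equiv_unordered_homotopy])

lemma gauss_phrase_mset_cong:
  "mset (concat P) = mset (concat Q) \<Longrightarrow> length P = length Q \<Longrightarrow>
    gauss_phrase n P \<longleftrightarrow> gauss_phrase n Q"
  unfolding gauss_phrase_def using gauss_word_mset_cong by metis

lemma phrase_sim_swap: "gauss_phrase 2 [a, b] \<Longrightarrow> [a, b] \<sim>\<^sub>p [b, a]"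
  by (rule phrase_step_imp_sim)
    (auto simp: phrase_step_def gauss_phrase_mset_cong[of "[b, a]" "[a, b]"] add.commute)

lemma phrase_sim_shift_left:
  assumes "gauss_phrase 2 [A # a, b]" shows "[A # a, b] \<sim>\<^sub>p [a @ [A], b]"
proof -
  have "gauss_phrase 2 [a @ [A], b]"
    using assms gauss_phrase_mset_cong[of "[a @ [A], b]" "[A # a, b]"] by simp
  then show ?thesis
    using assms phrase_shift.intros[of "[]" A a "[b]"]
    by (intro phrase_step_imp_sim) (simp add: phrase_step_def)
qed

lemma phrase_sim_shift_right:
  assumes "gauss_phrase 2 [a, A # b]" shows "[a, A # b] \<sim>\<^sub>p [a, b @ [A]]"
proof -
  have "gauss_phrase 2 [a, b @ [A]]"
    using assms gauss_phrase_mset_cong[of "[a, b @ [A]]" "[a, A # b]"] by simp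
  then show ?thesis
    using assms phrase_shift.intros[of "[a]" A b "[]"]
    by (intro phrase_step_imp_sim) (simp add: phrase_step_def)
qed

lemma gauss_word_map:
  assumes "gauss_word w" "inj_on f (set w)"
  shows "gauss_word (map f w)"
  using assms by (auto simp: gauss_word_def count_list_inj_map)

lemma phrase_sim_map:
  assumes "gauss_phrase 2 P" "inj_on f (set (concat P))"
  shows "P \<sim>\<^sub>p map (map f) P"
proof -
  have "gauss_word (map f (concat P))"
    using assms by (intro gauss_word_map) (auto simp: gauss_phrase_def)
  then have "gauss_phrase 2 (map (map f) P)"
    using assms by (simp add: gauss_phrase_def map_concat)
  moreover have "phrase_iso P (map (map f) P)"
    unfolding phrase_iso_def
    using assms(2) by (intro exI[of _ f]) (simp add: bij_betw_def flip: map_concat)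
  ultimately show ?thesis
    using assms(1) by (intro phrase_step_imp_sim) (simp add: phrase_step_def)
qed


section \<open>Homotopy of phrases written as symbol sequences\<close>

definition gauss_symbols :: "'a option list \<Rightarrow> bool" where
  "gauss_symbols s \<longleftrightarrow> (\<exists>P. gauss_phrase 2 P \<and> s = symbols P)"

text \<open>
  Unordered homotopy carried over to symbol sequences. Here a single equation covers every way in
  which a move can be spread over the two components.
\<close>

definition symbol_sim :: "'a option list \<Rightarrow> 'a option list \<Rightarrow> bool" (infix "\<asymp>" 50) where
  "s \<asymp> s' \<longleftrightarrow> (\<exists>P Q. P \<sim>\<^sub>p Q \<and> s = symbols P \<and> s' = symbols Q)"

lemma two_components: "gauss_phrase 2 P \<Longrightarrow> \<exists>a b. P = [a, b]"
  by (auto simp: gauss_phrase_def numeral_2_eq_2 length_Suc_conv)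

text \<open>This makes the transported relation transitive: the intermediate phrase is determined.\<close>

lemma symbols_inject:
  assumes "gauss_phrase 2 P" "gauss_phrase 2 Q" "symbols P = symbols Q"
  shows "P = Q"
proof -
  obtain a b a' b' where PQ: "P = [a, b]" "Q = [a', b']"
    using assms two_components by metis
  have "map Some a = map Some a' \<and> map Some b = map Some b'"
    using assms(3) by (intro first_occurrence_unique[of None]) (auto simp: PQ)
  then show ?thesis
    by (simp add: PQ inj_map_eq_map)
qed

lemma symbol_sim_sym: "s \<asymp> s' \<Longrightarrow> s' \<asymp> s"
  unfolding symbol_sim_def using phrase_sim_sym by blast

lemma symbol_sim_trans [trans]: "s \<asymp> s' \<Longrightarrow> s' \<asymp> s'' \<Longrightarrow> s \<asymp> s''"
  unfolding symbol_sim_def by (metis phrase_sim_gauss phrase_sim_trans symbols_inject)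

lemma symbol_sim_gauss: "s \<asymp> s' \<Longrightarrow> gauss_symbols s'"
  unfolding symbol_sim_def gauss_symbols_def using phrase_sim_gauss by blast

lemma phrase_simI:
  "gauss_phrase 2 P \<Longrightarrow> gauss_phrase 2 Q \<Longrightarrow> symbols P \<asymp> symbols Q \<Longrightarrow> P \<sim>\<^sub>p Q"
  unfolding symbol_sim_def by (metis phrase_sim_gauss symbols_inject)

lemma symbol_sim_move:
  "gauss_symbols s \<Longrightarrow> gauss_symbols s' \<Longrightarrow> symbol_move s s' \<Longrightarrow> s \<asymp> s'"
  unfolding gauss_symbols_def symbol_sim_def
  by (metis phrase_step_imp_sim phrase_step_def)

lemma gauss_word_iff: "gauss_word w \<longleftrightarrow> (\<forall>A. count_list w A = 0 \<or> count_list w A = 2)"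
  unfolding gauss_word_def by (metis count_list_0_iff zero_neq_numeral)

lemma count_list_map_Some:
  "count_list (map Some a) (Some A) = count_list a A" "count_list (map Some a) None = 0"
  by (induction a) auto

text \<open>
  Being the symbol sequence of a Gauss phrase is a matter of multiplicities only, so it can be
  checked for a rearranged sequence without looking at the order of its symbols.
\<close>

lemma gauss_symbols_iff:
  "gauss_symbols s \<longleftrightarrow> count_list s None = 1 \<and>
     (\<forall>A. count_list s (Some A) = 0 \<or> count_list s (Some A) = 2)" (is "_ \<longleftrightarrow> ?R")
proof
  assume "gauss_symbols s"
  then obtain a b where "s = symbols [a, b]" "gauss_phrase 2 [a, b]"
    unfolding gauss_symbols_def using two_components by metis
  then show ?R
    by (simp add: gauss_phrase_def gauss_word_iff count_list_map_Some)
next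
  assume R: ?R
  then have "None \<in> set s"
    by (metis count_list_0_iff zero_neq_one)
  then obtain x y where s: "s = x @ None # y"
    by (meson split_list)
  then have "None \<notin> set x" "None \<notin> set y"
    using R by (auto simp: count_list_0_iff)
  moreover have "z = map Some (map the z)" if "None \<notin> set z" for z :: "'a option list"
    using that by (induction z) auto
  ultimately obtain a b where ab: "x = map Some a" "y = map Some b"
    by metis
  show "gauss_symbols s"
    using R unfolding gauss_symbols_def
    by (intro exI[of _ "[a, b]"])
      (simp add: s ab gauss_phrase_def gauss_word_iff count_list_map_Some)
qed

lemma gauss_symbols_mset_cong:
  assumes "mset s = mset s'"
  shows "gauss_symbols s \<longleftrightarrow> gauss_symbols s'"
proof -
  have "count_list s = count_list s'"
    using assms by (auto simp: fun_eq_iff simp flip: count_mset)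
  then show ?thesis
    unfolding gauss_symbols_iff by simp
qed

lemma gauss_symbols_drop_letter:
  assumes "gauss_symbols (Some A # Some A # s)" shows "gauss_symbols s"
proof -
  have "count_list s (Some L) = 0 \<or> count_list s (Some L) = 2" for L
    using assms unfolding gauss_symbols_iff
    by (elim conjE allE[of _ L]) (auto split: if_splits)
  then show ?thesis
    using assms unfolding gauss_symbols_iff by simp
qed

lemma gauss_symbols_add_letter:
  "gauss_symbols s \<Longrightarrow> Some A \<notin> set s \<Longrightarrow> gauss_symbols (Some A # Some A # s)"
  unfolding gauss_symbols_iff by (auto simp: count_list_0_iff)

lemma symbol_sim_H1:
  assumes "gauss_symbols (x @ [Some A, Some A] @ y)"
  shows "x @ [Some A, Some A] @ y \<asymp> x @ y"
proof -
  have "gauss_symbols (x @ y)"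
    using assms gauss_symbols_drop_letter[of A "x @ y"]
      gauss_symbols_mset_cong[of "Some A # Some A # x @ y" "x @ [Some A, Some A] @ y"] by simp
  then show ?thesis
    using assms by (intro symbol_sim_move symbol_move.H1)
qed

lemma symbol_sim_H2:
  assumes "A \<noteq> B" "gauss_symbols (x @ [Some A, Some B] @ y @ [Some B, Some A] @ z)"
  shows "x @ [Some A, Some B] @ y @ [Some B, Some A] @ z \<asymp> x @ y @ z"
proof -
  have "gauss_symbols (x @ y @ z)"
    using assms gauss_symbols_drop_letter[of A "x @ y @ z"]
      gauss_symbols_drop_letter[of B "Some A # Some A # x @ y @ z"]
      gauss_symbols_mset_cong[of "Some B # Some B # Some A # Some A # x @ y @ z"
        "x @ [Some A, Some B] @ y @ [Some B, Some A] @ z"] by simp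
  then show ?thesis
    using assms by (intro symbol_sim_move symbol_move.H2) simp_all
qed

lemma symbol_sim_H2_insert:
  assumes "A \<noteq> B" "Some A \<notin> set (x @ y @ z)" "Some B \<notin> set (x @ y @ z)" "gauss_symbols (x @ y @ z)"
  shows "x @ y @ z \<asymp> x @ [Some A, Some B] @ y @ [Some B, Some A] @ z"
proof -
  have "gauss_symbols (Some A # Some A # Some B # Some B # x @ y @ z)"
    using assms by (intro gauss_symbols_add_letter) auto
  then have "gauss_symbols (x @ [Some A, Some B] @ y @ [Some B, Some A] @ z)"
    using gauss_symbols_mset_cong[of "Some A # Some A # Some B # Some B # x @ y @ z"
        "x @ [Some A, Some B] @ y @ [Some B, Some A] @ z"] by simp
  with assms(1) show ?thesis
    by (rule symbol_sim_sym[OF symbol_sim_H2])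
qed

lemma symbol_sim_H3:
  assumes "distinct [A, B, C]"
    "gauss_symbols (x @ [Some A, Some B] @ y @ [Some A, Some C] @ z @ [Some B, Some C] @ t)"
  shows "x @ [Some A, Some B] @ y @ [Some A, Some C] @ z @ [Some B, Some C] @ t \<asymp>
         x @ [Some B, Some A] @ y @ [Some C, Some A] @ z @ [Some C, Some B] @ t" (is "?s \<asymp> ?s'")
proof -
  have "gauss_symbols ?s'"
    using assms(2) gauss_symbols_mset_cong[of ?s ?s'] by simp
  then show ?thesis
    using assms by (intro symbol_sim_move symbol_move.H3)
qed

lemma symbol_sim_H3_reverse:
  assumes "distinct [A, B, C]"
    "gauss_symbols (x @ [Some B, Some A] @ y @ [Some C, Some A] @ z @ [Some C, Some B] @ t)"
  shows "x @ [Some B, Some A] @ y @ [Some C, Some A] @ z @ [Some C, Some B] @ t \<asymp>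
         x @ [Some A, Some B] @ y @ [Some A, Some C] @ z @ [Some B, Some C] @ t" (is "?s' \<asymp> ?s")
proof -
  have "gauss_symbols ?s"
    using assms(2) gauss_symbols_mset_cong[of ?s ?s'] by simp
  with assms(1) show ?thesis
    by (rule symbol_sim_sym[OF symbol_sim_H3])
qed

lemma symbols_map: "symbols (map (map f) P) = map (map_option f) (symbols P)"
  by (induction P rule: symbols.induct) auto

lemma symbol_sim_rename:
  assumes "gauss_symbols s" "Some F \<notin> set s"
  shows "s \<asymp> map (map_option (id(E := F))) s"
proof -
  obtain P where P: "gauss_phrase 2 P" "s = symbols P"
    using assms(1) unfolding gauss_symbols_def by blast
  then obtain a b where ab: "P = [a, b]"
    using two_components by blast
  have "inj_on (id(E := F)) (set (concat P))"
    using assms(2) unfolding P ab by (auto simp: inj_on_def)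
  then have "P \<sim>\<^sub>p map (map (id(E := F))) P"
    using P(1) by (rule phrase_sim_map[rotated])
  then show ?thesis
    unfolding symbol_sim_def P(2) symbols_map[symmetric] by blast
qed

lemma map_rename_absent:
  "Some E \<notin> set s \<Longrightarrow> map (map_option (id(E := F))) s = s"
  by (rule map_idI) (auto simp: map_option_case split: option.split)

section \<open>Derived moves\<close>

lemma fresh_letter_pair:
  fixes s :: "'a::infinite option list"
  obtains A B where "A \<noteq> B" "Some A \<notin> set s" "Some B \<notin> set s"
proof -
  obtain A where A: "A \<notin> the ` set s"
    using ex_new_if_finite[OF infinite_UNIV, of "the ` set s"] by auto
  obtain B where B: "B \<notin> insert A (the ` set s)"
    using ex_new_if_finite[OF infinite_UNIV, of "insert A (the ` set s)"] by auto
  show thesis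
    using A B by (intro that[of A B]) force+
qed

text \<open>
  Two strands that cross twice in parallel can be separated. The second \<open>AB\<close> is wrapped into \<open>UDABDU\<close>
  so that the crossings \<open>A\<close>, \<open>B\<close>, \<open>D\<close> form a triangle \<open>AB\<close>, \<open>DA\<close>, \<open>BD\<close>. In this triangle each letter comes
  first in one pair and second in the other, which H3 does not allow. A second bigon with letters
  \<open>V\<close>, \<open>E\<close> replaces \<open>B\<close> by \<open>E\<close> and reverses both pairs that contained it. The new triangle \<open>EA\<close>, \<open>DA\<close>, \<open>DE\<close>
  admits H3, after which all auxiliary letters cancel.
\<close>

lemma symbol_sim_H2_parallel:
  fixes A B :: "'a::infinite"
  assumes "A \<noteq> B" "gauss_symbols (x @ [Some A, Some B] @ y @ [Some A, Some B] @ z)"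
  shows "x @ [Some A, Some B] @ y @ [Some A, Some B] @ z \<asymp> x @ y @ z"
proof -
  obtain U D where UD: "U \<noteq> D" "Some U \<notin> set (x @ [Some A, Some B] @ y @ [Some A, Some B] @ z)"
      "Some D \<notin> set (x @ [Some A, Some B] @ y @ [Some A, Some B] @ z)"
    by (rule fresh_letter_pair)
  obtain V E where VE: "V \<noteq> E"
      "Some V \<notin> set (x @ [Some A, Some B] @ y @ [Some U, Some D, Some A, Some B, Some D, Some U] @ z)"
      "Some E \<notin> set (x @ [Some A, Some B] @ y @ [Some U, Some D, Some A, Some B, Some D, Some U] @ z)"
    by (rule fresh_letter_pair)
  have s1: "x @ [Some A, Some B] @ y @ [Some A, Some B] @ z \<asymp>
    x @ [Some A, Some B] @ y @ [Some U, Some D, Some A, Some B, Some D, Some U] @ z"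
    using symbol_sim_H2_insert[of U D "x @ [Some A, Some B] @ y" "[Some A, Some B]" z] UD assms
    by simp
  have s2: "x @ [Some A, Some B] @ y @ [Some U, Some D, Some A, Some B, Some D, Some U] @ z \<asymp>
    x @ [Some V, Some E, Some A, Some B] @ y @
      [Some U, Some D, Some A, Some B, Some D, Some E, Some V, Some U] @ z"
    using symbol_sim_H2_insert[of V E x "[Some A, Some B] @ y @ [Some U, Some D, Some A, Some B, Some D]"
      "Some U # z"] VE symbol_sim_gauss[OF s1]
    by simp
  have s3: "x @ [Some V, Some E, Some A, Some B] @ y @
      [Some U, Some D, Some A, Some B, Some D, Some E, Some V, Some U] @ z \<asymp>
    x @ [Some V, Some A, Some E, Some B] @ y @
      [Some U, Some A, Some D, Some B, Some E, Some D, Some V, Some U] @ z"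
    using symbol_sim_H3_reverse[of A E D "x @ [Some V]" "[Some B] @ y @ [Some U]" "[Some B]"
      "[Some V, Some U] @ z"] UD VE symbol_sim_gauss[OF s2]
    by auto
  have s4: "x @ [Some V, Some A, Some E, Some B] @ y @
      [Some U, Some A, Some D, Some B, Some E, Some D, Some V, Some U] @ z \<asymp>
    x @ [Some V, Some A] @ y @ [Some U, Some A, Some D, Some D, Some V, Some U] @ z"
    using symbol_sim_H2[of E B "x @ [Some V, Some A]" "y @ [Some U, Some A, Some D]"
      "[Some D, Some V, Some U] @ z"] VE symbol_sim_gauss[OF s3]
    by auto
  have s5: "x @ [Some V, Some A] @ y @ [Some U, Some A, Some D, Some D, Some V, Some U] @ z \<asymp>
    x @ [Some V, Some A] @ y @ [Some U, Some A, Some V, Some U] @ z"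
    using symbol_sim_H1[of "x @ [Some V, Some A] @ y @ [Some U, Some A]" D "[Some V, Some U] @ z"]
      symbol_sim_gauss[OF s4]
    by simp
  have s6: "x @ [Some V, Some A] @ y @ [Some U, Some A, Some V, Some U] @ z \<asymp>
    x @ y @ [Some U, Some U] @ z"
    using symbol_sim_H2[of V A x "y @ [Some U]" "[Some U] @ z"] VE symbol_sim_gauss[OF s5]
    by auto
  have s7: "x @ y @ [Some U, Some U] @ z \<asymp> x @ y @ z"
    using symbol_sim_H1[of "x @ y" U z] symbol_sim_gauss[OF s6] by simp
  note s1 also note s2 also note s3 also note s4 also note s5 also note s6 also note s7
  finally show ?thesis .
qed

lemma symbol_sim_H2_parallel_insert:
  fixes A B :: "'a::infinite"
  assumes "A \<noteq> B" "Some A \<notin> set (x @ y @ z)" "Some B \<notin> set (x @ y @ z)" "gauss_symbols (x @ y @ z)"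
  shows "x @ y @ z \<asymp> x @ [Some A, Some B] @ y @ [Some A, Some B] @ z"
proof -
  have "gauss_symbols (Some A # Some A # Some B # Some B # x @ y @ z)"
    using assms by (intro gauss_symbols_add_letter) auto
  then have "gauss_symbols (x @ [Some A, Some B] @ y @ [Some A, Some B] @ z)"
    using gauss_symbols_mset_cong[of "Some A # Some A # Some B # Some B # x @ y @ z"
        "x @ [Some A, Some B] @ y @ [Some A, Some B] @ z"] by simp
  with assms(1) show ?thesis
    by (rule symbol_sim_sym[OF symbol_sim_H2_parallel])
qed

lemma gauss_symbols_twice:
  "gauss_symbols (Some A # Some A # s) \<Longrightarrow> Some A \<notin> set s"
  unfolding gauss_symbols_iff by (elim conjE allE[of _ A]) (auto simp: count_list_0_iff)

text \<open>
  H3 with its displayed subwords in the cyclic orders \<open>AC\<close>, \<open>BC\<close>, \<open>AB\<close> and \<open>BC\<close>, \<open>AB\<close>, \<open>AC\<close>. The original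
  move asks that the first and last subwords share the letter that is first in one subword and second in
  another. Inserting a parallel bigon (with letters \<open>D\<close>, \<open>E\<close>) next to one of the letters puts a fresh letter in its
  place and reverses the two subwords containing it. With the right choice of that letter
  (\<open>C\<close> in the first case, \<open>A\<close> in the second) the new triangle has the order required by H3. The old
  letter then cancels against one fresh letter, and the other fresh letter is renamed to it.
\<close>

lemma symbol_sim_H3_231:
  fixes A B C :: "'a::infinite"
  assumes "distinct [A, B, C]"
    and gauss: "gauss_symbols (x @ [Some A, Some C] @ y @ [Some B, Some C] @ z @ [Some A, Some B] @ t)"
  shows "x @ [Some A, Some C] @ y @ [Some B, Some C] @ z @ [Some A, Some B] @ t \<asymp>
         x @ [Some C, Some A] @ y @ [Some C, Some B] @ z @ [Some B, Some A] @ t"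
proof -
  obtain D E where DE: "D \<noteq> E"
      "Some D \<notin> set (x @ [Some A, Some C] @ y @ [Some B, Some C] @ z @ [Some A, Some B] @ t)"
      "Some E \<notin> set (x @ [Some A, Some C] @ y @ [Some B, Some C] @ z @ [Some A, Some B] @ t)"
    by (rule fresh_letter_pair)
  have C: "Some C \<notin> set (x @ Some A # y @ Some B # z @ [Some A, Some B] @ t)"
    using gauss gauss_symbols_mset_cong[of
        "x @ [Some A, Some C] @ y @ [Some B, Some C] @ z @ [Some A, Some B] @ t"
        "Some C # Some C # x @ Some A # y @ Some B # z @ [Some A, Some B] @ t"]
    by (intro gauss_symbols_twice) simp
  have s1: "x @ [Some A, Some C] @ y @ [Some B, Some C] @ z @ [Some A, Some B] @ t \<asymp>
    x @ [Some E, Some D, Some A, Some C] @ y @ [Some E, Some D, Some B, Some C] @ z @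
      [Some A, Some B] @ t"
    using symbol_sim_H2_parallel_insert[of E D x "[Some A, Some C] @ y"
        "[Some B, Some C] @ z @ [Some A, Some B] @ t"] DE gauss by simp
  have s2: "x @ [Some E, Some D, Some A, Some C] @ y @ [Some E, Some D, Some B, Some C] @ z @
      [Some A, Some B] @ t \<asymp>
    x @ [Some E, Some A, Some D, Some C] @ y @ [Some E, Some B, Some D, Some C] @ z @
      [Some B, Some A] @ t"
    using symbol_sim_H3[of D A B "x @ [Some E]" "[Some C] @ y @ [Some E]" "[Some C] @ z" t]
      DE assms(1) symbol_sim_gauss[OF s1] by auto
  have s3: "x @ [Some E, Some A, Some D, Some C] @ y @ [Some E, Some B, Some D, Some C] @ z @
      [Some B, Some A] @ t \<asymp>
    x @ [Some E, Some A] @ y @ [Some E, Some B] @ z @ [Some B, Some A] @ t"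
    using symbol_sim_H2_parallel[of D C "x @ [Some E, Some A]" "y @ [Some E, Some B]"
        "z @ [Some B, Some A] @ t"] DE symbol_sim_gauss[OF s2] by auto
  have s4: "x @ [Some E, Some A] @ y @ [Some E, Some B] @ z @ [Some B, Some A] @ t \<asymp>
    x @ [Some C, Some A] @ y @ [Some C, Some B] @ z @ [Some B, Some A] @ t"
    using symbol_sim_rename[OF symbol_sim_gauss[OF s3], of C E] C DE assms(1)
    by (auto simp: map_rename_absent)
  note s1 also note s2 also note s3 also note s4
  finally show ?thesis .
qed

lemma symbol_sim_H3_312:
  fixes A B C :: "'a::infinite"
  assumes "distinct [A, B, C]"
    and gauss: "gauss_symbols (x @ [Some B, Some C] @ y @ [Some A, Some B] @ z @ [Some A, Some C] @ t)"
  shows "x @ [Some B, Some C] @ y @ [Some A, Some B] @ z @ [Some A, Some C] @ t \<asymp>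
         x @ [Some C, Some B] @ y @ [Some B, Some A] @ z @ [Some C, Some A] @ t"
proof -
  obtain D E where DE: "D \<noteq> E"
      "Some D \<notin> set (x @ [Some B, Some C] @ y @ [Some A, Some B] @ z @ [Some A, Some C] @ t)"
      "Some E \<notin> set (x @ [Some B, Some C] @ y @ [Some A, Some B] @ z @ [Some A, Some C] @ t)"
    by (rule fresh_letter_pair)
  have A: "Some A \<notin> set (x @ [Some B, Some C] @ y @ Some B # z @ Some C # t)"
    using gauss gauss_symbols_mset_cong[of
        "x @ [Some B, Some C] @ y @ [Some A, Some B] @ z @ [Some A, Some C] @ t"
        "Some A # Some A # x @ [Some B, Some C] @ y @ Some B # z @ Some C # t"]
    by (intro gauss_symbols_twice) simp
  have s1: "x @ [Some B, Some C] @ y @ [Some A, Some B] @ z @ [Some A, Some C] @ t \<asymp>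
    x @ [Some B, Some C] @ y @ [Some A, Some B, Some D, Some E] @ z @
      [Some A, Some C, Some D, Some E] @ t"
    using symbol_sim_H2_parallel_insert[of D E "x @ [Some B, Some C] @ y @ [Some A, Some B]"
        "z @ [Some A, Some C]" t] DE gauss by simp
  have s2: "x @ [Some B, Some C] @ y @ [Some A, Some B, Some D, Some E] @ z @
      [Some A, Some C, Some D, Some E] @ t \<asymp>
    x @ [Some C, Some B] @ y @ [Some A, Some D, Some B, Some E] @ z @
      [Some A, Some D, Some C, Some E] @ t"
    using symbol_sim_H3[of B C D x "y @ [Some A]" "[Some E] @ z @ [Some A]" "[Some E] @ t"]
      DE assms(1) symbol_sim_gauss[OF s1] by auto
  have s3: "x @ [Some C, Some B] @ y @ [Some A, Some D, Some B, Some E] @ z @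
      [Some A, Some D, Some C, Some E] @ t \<asymp>
    x @ [Some C, Some B] @ y @ [Some B, Some E] @ z @ [Some C, Some E] @ t"
    using symbol_sim_H2_parallel[of A D "x @ [Some C, Some B] @ y" "[Some B, Some E] @ z"
        "[Some C, Some E] @ t"] DE symbol_sim_gauss[OF s2] by auto
  have s4: "x @ [Some C, Some B] @ y @ [Some B, Some E] @ z @ [Some C, Some E] @ t \<asymp>
    x @ [Some C, Some B] @ y @ [Some B, Some A] @ z @ [Some C, Some A] @ t"
    using symbol_sim_rename[OF symbol_sim_gauss[OF s3], of A E] A DE assms(1)
    by (auto simp: map_rename_absent)
  note s1 also note s2 also note s3 also note s4
  finally show ?thesis .
qed

section \<open>The phrase attached to a letter, read off a rotated word\<close>

lemma gauss_word_rotate: "gauss_word (x @ y) \<longleftrightarrow> gauss_word (y @ x)"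
  by (rule gauss_word_mset_cong) simp

lemma u_class_split:
  "gauss_word (x @ A # y @ A # z) \<Longrightarrow> u_class (x @ A # y @ A # z) A = GP_class 2 [y, x @ z]"
  using p_phrase_eq[of x A y z] by (simp add: u_class_def)

lemma gauss_phrase_split:
  "gauss_word (x @ A # y @ A # z) \<Longrightarrow> gauss_phrase 2 [y, x @ z]"
  using gauss_phrase_p[of "x @ A # y @ A # z" A] p_phrase_eq[of x A y z] by simp

text \<open>
  If the rotated letter is \<open>D\<close> itself, the two components trade places; otherwise the outer component
  is shifted. This uses both the shifts and the unordered components of phrases.
\<close>

lemma u_class_rotate1:
  assumes "gauss_word (A # r)" "D \<in> set (A # r)"
  shows "u_class (A # r) D = u_class (r @ [A]) D"
proof -
  have g: "gauss_word (r @ [A])"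
    using assms(1) gauss_word_rotate[of "[A]" r] by simp
  obtain x y z where w: "A # r = x @ [D] @ y @ [D] @ z"
    using gauss_word_split[OF assms] .
  show ?thesis
  proof (cases x)
    case Nil
    then have r: "A = D" "r = y @ D # z"
      using w by auto
    have "[y, z] \<sim>\<^sub>p [z, y]"
      using assms(1) gauss_phrase_split[of "[]" D y z] by (intro phrase_sim_swap) (simp add: r)
    then show ?thesis
      using assms(1) g u_class_split[of "[]" D y z] u_class_split[of y D z "[]"]
        GP_class_eqI by (simp add: r)
  next
    case (Cons B x')
    then have r: "r = x' @ D # y @ D # z" "x = A # x'"
      using w by auto
    have "[y, A # x' @ z] \<sim>\<^sub>p [y, (x' @ z) @ [A]]"
      using assms(1) gauss_phrase_split[of x D y z]
      by (intro phrase_sim_shift_right) (simp add: r)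
    then show ?thesis
      using assms(1) g u_class_split[of x D y z] u_class_split[of x' D y "z @ [A]"]
        GP_class_eqI by (simp add: r)
  qed
qed

lemma u_class_rotate:
  assumes "gauss_word (x @ y)" "D \<in> set (x @ y)"
  shows "u_class (x @ y) D = u_class (y @ x) D"
  using assms
proof (induction x arbitrary: y)
  case (Cons A x)
  have "u_class (A # x @ y) D = u_class (x @ y @ [A]) D"
    using u_class_rotate1[of A "x @ y" D] Cons.prems by simp
  also have "\<dots> = u_class (y @ A # x) D"
    using Cons.IH[of "y @ [A]"] Cons.prems gauss_word_rotate[of "[A]" "x @ y"] by auto
  finally show ?case by simp
qed simp

text \<open>
  When \<open>w\<close> starts with \<open>D\<close>, this turns the rest of \<open>w\<close> into the symbol sequence of the phrase of \<open>D\<close>. It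
  commutes with concatenation, so that a move on the rest of \<open>w\<close> is visibly a move on the phrase.
\<close>

definition mark :: "'a \<Rightarrow> 'a list \<Rightarrow> 'a option list" where
  "mark D w = map (\<lambda>L. if L = D then None else Some L) w"

lemma mark_simps [simp]:
  "mark D [] = []"
  "mark D (L # w) = (if L = D then None else Some L) # mark D w"
  "mark D (u @ v) = mark D u @ mark D v"
  by (simp_all add: mark_def)

lemma mark_absent: "D \<notin> set w \<Longrightarrow> mark D w = map Some w"
  by (auto simp: mark_def)

lemma phrase_of_mark:
  assumes "gauss_word (D # r)"
  obtains y z where "gauss_phrase 2 [y, z]" "symbols [y, z] = mark D r"
    "u_class (D # r) D = GP_class 2 [y, z]"
proof -
  have c: "count_list r D = 1"
    using assms by (auto simp: gauss_word_def)
  then obtain y z where r: "r = y @ D # z"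
    by (metis count_list_0_iff split_list zero_neq_one)
  then have "D \<notin> set y" "D \<notin> set z"
    using c by (auto simp: count_list_0_iff)
  then show thesis
    using assms gauss_phrase_split[of "[]" D y z] u_class_split[of "[]" D y z]
    by (intro that[of y z]) (simp_all add: r mark_absent)
qed

lemma gauss_symbols_mark: "gauss_word (D # r) \<Longrightarrow> gauss_symbols (mark D r)"
  by (metis gauss_symbols_def phrase_of_mark)

text \<open>
  The tool for letters not displayed in a move: any occurrence of \<open>D\<close> may be chosen as the cutting
  point, so only the segment in which it lies has to be distinguished, not the pair of segments
  containing both occurrences.
\<close>

lemma u_class_eqI:
  assumes "gauss_word (a @ D # b)" "gauss_word (a' @ D # b')"
    and "gauss_symbols (mark D (b @ a)) \<Longrightarrow> mark D (b @ a) \<asymp> mark D (b' @ a')"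
  shows "u_class (a @ D # b) D = u_class (a' @ D # b') D"
proof -
  have g: "gauss_word (D # b @ a)" "gauss_word (D # b' @ a')"
    using assms(1,2) gauss_word_rotate[of a "D # b"] gauss_word_rotate[of a' "D # b'"] by simp_all
  obtain y z where P: "gauss_phrase 2 [y, z]" "symbols [y, z] = mark D (b @ a)"
    "u_class (D # b @ a) D = GP_class 2 [y, z]"
    using phrase_of_mark[OF g(1)] .
  obtain y' z' where Q: "gauss_phrase 2 [y', z']" "symbols [y', z'] = mark D (b' @ a')"
    "u_class (D # b' @ a') D = GP_class 2 [y', z']"
    using phrase_of_mark[OF g(2)] .
  have "symbols [y, z] \<asymp> symbols [y', z']"
    unfolding P(2) Q(2) by (rule assms(3)[OF gauss_symbols_mark[OF g(1)]])
  then have "[y, z] \<sim>\<^sub>p [y', z']"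
    by (rule phrase_simI[OF P(1) Q(1)])
  then show ?thesis
    using assms(1,2) u_class_rotate[of a "D # b" D] u_class_rotate[of a' "D # b'" D] P(3) Q(3)
      GP_class_eqI by simp
qed

lemma t_class_eqI:
  assumes "gauss_word w" "gauss_word w'"
    and "gauss_symbols (None # map Some w) \<Longrightarrow> None # map Some w \<asymp> None # map Some w'"
  shows "t_class w = t_class w'"
proof -
  have "gauss_symbols (None # map Some w)"
    unfolding gauss_symbols_def using gauss_phrase_t[OF assms(1)]
    by (intro exI[of _ "[[], w]"]) simp
  then have "[[], w] \<sim>\<^sub>p [[], w']"
    using assms gauss_phrase_t by (intro phrase_simI) simp_all
  then show ?thesis
    unfolding t_class_def by (rule GP_class_eqI)
qed

lemma t_class_rotate1:
  assumes "gauss_word (A # r)"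
  shows "t_class (A # r) = t_class (r @ [A])"
  unfolding t_class_def
  by (intro GP_class_eqI phrase_sim_shift_right gauss_phrase_t assms)

section \<open>Effect of the moves on the classes\<close>

lemma gauss_word_H1_fresh:
  assumes "gauss_word (x @ [A, A] @ y)"
  shows "A \<notin> set (x @ y)"
  using assms by (auto simp: gauss_word_iff count_list_0_iff split: if_splits dest!: spec[of _ A])

lemma gauss_word_H2_fresh:
  assumes "gauss_word (x @ [A, B] @ y @ [B, A] @ z)" "A \<noteq> B"
  shows "A \<notin> set (x @ y @ z)" "B \<notin> set (x @ y @ z)"
  using assms by (auto simp: gauss_word_def count_list_0_iff)

lemma gauss_word_H3_fresh:
  assumes "gauss_word (x @ [A, B] @ y @ [A, C] @ z @ [B, C] @ t)" "distinct [A, B, C]"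
  shows "A \<notin> set (x @ y @ z @ t)" "B \<notin> set (x @ y @ z @ t)" "C \<notin> set (x @ y @ z @ t)"
  using assms by (auto simp: gauss_word_def count_list_0_iff)

lemma u_class_H1_other:
  assumes g: "gauss_word (x @ [A, A] @ y)" "gauss_word (x @ y)" and D: "D \<in> set (x @ y)"
  shows "u_class (x @ [A, A] @ y) D = u_class (x @ y) D"
proof -
  have DA: "A \<noteq> D"
    using gauss_word_H1_fresh[OF g(1)] D by auto
  from D consider "D \<in> set x" | "D \<in> set y" by auto
  then show ?thesis
  proof cases
    case 1
    then obtain a b where s: "x = a @ D # b" by (meson split_list)
    show ?thesis
      using u_class_eqI[of a D "b @ [A, A] @ y" a "b @ y"] g DA
        symbol_sim_H1[of "mark D b" A "mark D y @ mark D a"]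
      by (simp add: s)
  next
    case 2
    then obtain a b where s: "y = a @ D # b" by (meson split_list)
    show ?thesis
      using u_class_eqI[of "x @ [A, A] @ a" D b "x @ a" b] g DA
        symbol_sim_H1[of "mark D b @ mark D x" A "mark D a"]
      by (simp add: s)
  qed
qed

lemma u_class_H2_other:
  assumes g: "gauss_word (x @ [A, B] @ y @ [B, A] @ z)" "gauss_word (x @ y @ z)"
    and AB: "A \<noteq> B" and D: "D \<in> set (x @ y @ z)"
  shows "u_class (x @ [A, B] @ y @ [B, A] @ z) D = u_class (x @ y @ z) D"
proof -
  have DA: "A \<noteq> D" "B \<noteq> D"
    using gauss_word_H2_fresh[OF g(1) AB] D by auto
  from D consider "D \<in> set x" | "D \<in> set y" | "D \<in> set z" by auto
  then show ?thesis
  proof cases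
    case 1
    then obtain a b where s: "x = a @ D # b" by (meson split_list)
    show ?thesis
      using u_class_eqI[of a D "b @ [A, B] @ y @ [B, A] @ z" a "b @ y @ z"] g DA AB
        symbol_sim_H2[of A B "mark D b" "mark D y" "mark D z @ mark D a"]
      by (simp add: s)
  next
    case 2
    then obtain a b where s: "y = a @ D # b" by (meson split_list)
    \<comment> \<open>the rotation puts \<open>BA\<close> before \<open>AB\<close>, which is H2 with the roles of the letters exchanged\<close>
    show ?thesis
      using u_class_eqI[of "x @ [A, B] @ a" D "b @ [B, A] @ z" "x @ a" "b @ z"] g DA AB
        symbol_sim_H2[of B A "mark D b" "mark D z @ mark D x" "mark D a"]
      by (simp add: s)
  next
    case 3
    then obtain a b where s: "z = a @ D # b" by (meson split_list)
    show ?thesis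
      using u_class_eqI[of "x @ [A, B] @ y @ [B, A] @ a" D b "x @ y @ a" b] g DA AB
        symbol_sim_H2[of A B "mark D b @ mark D x" "mark D y" "mark D a"]
      by (simp add: s)
  qed
qed

lemma u_class_H3_other:
  fixes A B C D :: "'a::infinite"
  assumes g: "gauss_word (x @ [A, B] @ y @ [A, C] @ z @ [B, C] @ t)"
      "gauss_word (x @ [B, A] @ y @ [C, A] @ z @ [C, B] @ t)"
    and ABC: "distinct [A, B, C]" and D: "D \<in> set (x @ y @ z @ t)"
  shows "u_class (x @ [A, B] @ y @ [A, C] @ z @ [B, C] @ t) D =
         u_class (x @ [B, A] @ y @ [C, A] @ z @ [C, B] @ t) D"
proof -
  have DA: "A \<noteq> D" "B \<noteq> D" "C \<noteq> D"
    using gauss_word_H3_fresh[OF g(1) ABC] D by auto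
  from D consider "D \<in> set x" | "D \<in> set y" | "D \<in> set z" | "D \<in> set t" by auto
  then show ?thesis
  proof cases
    case 1
    then obtain a b where s: "x = a @ D # b" by (meson split_list)
    show ?thesis
      using u_class_eqI[of a D "b @ [A, B] @ y @ [A, C] @ z @ [B, C] @ t"
          a "b @ [B, A] @ y @ [C, A] @ z @ [C, B] @ t"] g DA ABC
        symbol_sim_H3[of A B C "mark D b" "mark D y" "mark D z" "mark D t @ mark D a"]
      by (simp add: s)
  next
    case 2
    then obtain a b where s: "y = a @ D # b" by (meson split_list)
    show ?thesis
      using u_class_eqI[of "x @ [A, B] @ a" D "b @ [A, C] @ z @ [B, C] @ t"
          "x @ [B, A] @ a" "b @ [C, A] @ z @ [C, B] @ t"] g DA ABC
        symbol_sim_H3_231[of A B C "mark D b" "mark D z" "mark D t @ mark D x" "mark D a"]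
      by (simp add: s)
  next
    case 3
    then obtain a b where s: "z = a @ D # b" by (meson split_list)
    show ?thesis
      using u_class_eqI[of "x @ [A, B] @ y @ [A, C] @ a" D "b @ [B, C] @ t"
          "x @ [B, A] @ y @ [C, A] @ a" "b @ [C, B] @ t"] g DA ABC
        symbol_sim_H3_312[of A B C "mark D b" "mark D t @ mark D x" "mark D y" "mark D a"]
      by (simp add: s)
  next
    case 4
    then obtain a b where s: "t = a @ D # b" by (meson split_list)
    show ?thesis
      using u_class_eqI[of "x @ [A, B] @ y @ [A, C] @ z @ [B, C] @ a" D b
          "x @ [B, A] @ y @ [C, A] @ z @ [C, B] @ a" b] g DA ABC
        symbol_sim_H3[of A B C "mark D b @ mark D x" "mark D y" "mark D z" "mark D a"]
      by (simp add: s)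
  qed
qed

lemma t_class_H1:
  assumes "gauss_word (x @ [A, A] @ y)" "gauss_word (x @ y)"
  shows "t_class (x @ [A, A] @ y) = t_class (x @ y)"
  using t_class_eqI[OF assms] symbol_sim_H1[of "None # map Some x" A "map Some y"] by simp

lemma t_class_H2:
  assumes "gauss_word (x @ [A, B] @ y @ [B, A] @ z)" "gauss_word (x @ y @ z)" "A \<noteq> B"
  shows "t_class (x @ [A, B] @ y @ [B, A] @ z) = t_class (x @ y @ z)"
  using t_class_eqI[OF assms(1,2)] assms(3)
    symbol_sim_H2[of A B "None # map Some x" "map Some y" "map Some z"] by simp

lemma t_class_H3:
  assumes "gauss_word (x @ [A, B] @ y @ [A, C] @ z @ [B, C] @ t)"
    "gauss_word (x @ [B, A] @ y @ [C, A] @ z @ [C, B] @ t)" "distinct [A, B, C]"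
  shows "t_class (x @ [A, B] @ y @ [A, C] @ z @ [B, C] @ t) =
         t_class (x @ [B, A] @ y @ [C, A] @ z @ [C, B] @ t)"
  using t_class_eqI[OF assms(1,2)] assms(3)
    symbol_sim_H3[of A B C "None # map Some x" "map Some y" "map Some z" "map Some t"] by simp

lemma u_class_H1_self:
  assumes "gauss_word (x @ [A, A] @ y)"
  shows "u_class (x @ [A, A] @ y) A = t_class (x @ y)"
  using u_class_split[of x A "[]" y] assms by (simp add: t_class_def)

text \<open>The phrases \<open>ByB|xz\<close> and \<open>y|xAAz\<close> both reduce to \<open>y|xz\<close> by H1, the former after a shift.\<close>

lemma u_class_H2_self:
  assumes g: "gauss_word (x @ [A, B] @ y @ [B, A] @ z)" and AB: "A \<noteq> B"
  shows "u_class (x @ [A, B] @ y @ [B, A] @ z) A = u_class (x @ [A, B] @ y @ [B, A] @ z) B"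
proof -
  have gA: "gauss_phrase 2 [B # y @ [B], x @ z]"
    using gauss_phrase_split[of x A "B # y @ [B]" z] g by simp
  have gB: "gauss_phrase 2 [y, x @ [A, A] @ z]"
    using gauss_phrase_split[of "x @ [A]" B y "A # z"] g by simp
  have shift: "[B # y @ [B], x @ z] \<sim>\<^sub>p [y @ [B, B], x @ z]"
    using phrase_sim_shift_left[OF gA] by simp
  have "symbols [y @ [B, B], x @ z] \<asymp> map Some y @ None # map Some (x @ z)"
    using symbol_sim_H1[of "map Some y" B "None # map Some (x @ z)"] phrase_sim_gauss[OF shift]
    by (force simp: gauss_symbols_def)
  also have "\<dots> \<asymp> symbols [y, x @ [A, A] @ z]"
    using symbol_sim_sym[OF symbol_sim_H1[of "map Some y @ None # map Some x" A "map Some z"]] gB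
    by (force simp: gauss_symbols_def)
  finally have "[y @ [B, B], x @ z] \<sim>\<^sub>p [y, x @ [A, A] @ z]"
    using phrase_sim_gauss[OF shift] gB phrase_simI by blast
  with shift have "[B # y @ [B], x @ z] \<sim>\<^sub>p [y, x @ [A, A] @ z]"
    by (rule phrase_sim_trans)
  then show ?thesis
    using u_class_split[of x A "B # y @ [B]" z] u_class_split[of "x @ [A]" B y "A # z"] g GP_class_eqI
    by simp
qed

lemma map_transpose_absent:
  "A \<notin> set w \<Longrightarrow> B \<notin> set w \<Longrightarrow> map (transpose A B) w = w"
  by (rule map_idI) (metis transpose_apply_other)

text \<open>
  The phrases are \<open>By|xCzBCt\<close> and \<open>yC|xBzCBt\<close>; a shift of the first component followed by exchanging the
  names \<open>B\<close> and \<open>C\<close> takes one to the other.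
\<close>

lemma u_class_H3_self_A:
  assumes g: "gauss_word (x @ [A, B] @ y @ [A, C] @ z @ [B, C] @ t)"
      "gauss_word (x @ [B, A] @ y @ [C, A] @ z @ [C, B] @ t)"
    and ABC: "distinct [A, B, C]"
  shows "u_class (x @ [A, B] @ y @ [A, C] @ z @ [B, C] @ t) A =
         u_class (x @ [B, A] @ y @ [C, A] @ z @ [C, B] @ t) A"
proof -
  note fresh = gauss_word_H3_fresh[OF g(1) ABC]
  have "gauss_phrase 2 [B # y, x @ [C] @ z @ [B, C] @ t]"
    using gauss_phrase_split[of x A "B # y" "C # z @ [B, C] @ t"] g(1) by simp
  then have shift: "[B # y, x @ [C] @ z @ [B, C] @ t] \<sim>\<^sub>p [y @ [B], x @ [C] @ z @ [B, C] @ t]"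
    by (rule phrase_sim_shift_left)
  also have "\<dots> \<sim>\<^sub>p map (map (transpose B C)) [y @ [B], x @ [C] @ z @ [B, C] @ t]"
    using phrase_sim_gauss[OF shift]
    by (intro phrase_sim_map inj_on_subset[OF inj_transpose]) auto
  also have "\<dots> = [y @ [C], x @ [B] @ z @ [C, B] @ t]"
    using fresh by (simp add: map_transpose_absent)
  finally show ?thesis
    using u_class_split[of x A "B # y" "C # z @ [B, C] @ t"]
      u_class_split[of "x @ [B]" A "y @ [C]" "z @ [C, B] @ t"] g GP_class_eqI by simp
qed

text \<open>Likewise for \<open>zB|xAByAt\<close> and \<open>Az|xBAyBt\<close>, exchanging \<open>A\<close> and \<open>B\<close>.\<close>

lemma u_class_H3_self_C:
  assumes g: "gauss_word (x @ [A, B] @ y @ [A, C] @ z @ [B, C] @ t)"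
      "gauss_word (x @ [B, A] @ y @ [C, A] @ z @ [C, B] @ t)"
    and ABC: "distinct [A, B, C]"
  shows "u_class (x @ [A, B] @ y @ [A, C] @ z @ [B, C] @ t) C =
         u_class (x @ [B, A] @ y @ [C, A] @ z @ [C, B] @ t) C"
proof -
  note fresh = gauss_word_H3_fresh[OF g(1) ABC]
  have "gauss_phrase 2 [A # z, x @ [B, A] @ y @ [B] @ t]"
    using gauss_phrase_split[of "x @ [B, A] @ y" C "A # z" "B # t"] g(2) by simp
  then have shift: "[A # z, x @ [B, A] @ y @ [B] @ t] \<sim>\<^sub>p [z @ [A], x @ [B, A] @ y @ [B] @ t]"
    by (rule phrase_sim_shift_left)
  also have "\<dots> \<sim>\<^sub>p map (map (transpose A B)) [z @ [A], x @ [B, A] @ y @ [B] @ t]"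
    using phrase_sim_gauss[OF shift]
    by (intro phrase_sim_map inj_on_subset[OF inj_transpose]) auto
  also have "\<dots> = [z @ [B], x @ [A, B] @ y @ [A] @ t]"
    using fresh by (simp add: map_transpose_absent)
  finally have "[A # z, x @ [B, A] @ y @ [B] @ t] \<sim>\<^sub>p [z @ [B], x @ [A, B] @ y @ [A] @ t]" .
  from GP_class_eqI[OF this] show ?thesis
    using u_class_split[of "x @ [A, B] @ y @ [A]" C "z @ [B]" t]
      u_class_split[of "x @ [B, A] @ y" C "A # z" "B # t"] g by simp
qed

text \<open>
  The phrases \<open>yACz|xACt\<close> and \<open>AyCAzC|xt\<close> are not related by any renaming: \<open>A\<close> and \<open>C\<close> join the two
  components only in the former. Deleting parallel subwords reduces both to \<open>yz|xt\<close>.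
\<close>

lemma u_class_H3_self_B:
  fixes A B C :: "'a::infinite"
  assumes g: "gauss_word (x @ [A, B] @ y @ [A, C] @ z @ [B, C] @ t)"
      "gauss_word (x @ [B, A] @ y @ [C, A] @ z @ [C, B] @ t)"
    and ABC: "distinct [A, B, C]"
  shows "u_class (x @ [A, B] @ y @ [A, C] @ z @ [B, C] @ t) B =
         u_class (x @ [B, A] @ y @ [C, A] @ z @ [C, B] @ t) B"
proof -
  have P: "gauss_phrase 2 [y @ [A, C] @ z, x @ [A, C] @ t]"
    using gauss_phrase_split[of "x @ [A]" B "y @ [A, C] @ z" "C # t"] g(1) by simp
  have "gauss_phrase 2 [A # y @ [C, A] @ z @ [C], x @ t]"
    using gauss_phrase_split[of x B "A # y @ [C, A] @ z @ [C]" t] g(2) by simp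
  from phrase_sim_shift_left[OF this]
  have shift: "[A # y @ [C, A] @ z @ [C], x @ t] \<sim>\<^sub>p [y @ [C, A] @ z @ [C, A], x @ t]"
    by simp
  have Q: "gauss_phrase 2 [y @ [C, A] @ z @ [C, A], x @ t]"
    using phrase_sim_gauss[OF shift] by blast
  have "symbols [y @ [A, C] @ z, x @ [A, C] @ t] \<asymp> map Some y @ (map Some z @ None # map Some x) @ map Some t"
    using symbol_sim_H2_parallel[of A C "map Some y" "map Some z @ None # map Some x" "map Some t"]
      P ABC by (force simp: gauss_symbols_def)
  also have "\<dots> \<asymp> symbols [y @ [C, A] @ z @ [C, A], x @ t]"
    using symbol_sim_sym[OF symbol_sim_H2_parallel[of C A "map Some y" "map Some z" "None # map Some (x @ t)"]]
      Q ABC by (force simp: gauss_symbols_def)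
  finally have "[y @ [A, C] @ z, x @ [A, C] @ t] \<sim>\<^sub>p [y @ [C, A] @ z @ [C, A], x @ t]"
    by (rule phrase_simI[OF P Q])
  also note phrase_sim_sym[OF shift]
  finally show ?thesis
    using u_class_split[of "x @ [A]" B "y @ [A, C] @ z" "C # t"]
      u_class_split[of x B "A # y @ [C, A] @ z @ [C]" t] g GP_class_eqI by simp
qed

section \<open>Invariance of z\<close>

lemma g_map_cong:
  assumes "set w = set w'" "t_class w = t_class w'" "\<And>A. A \<in> set w \<Longrightarrow> u_class w A = u_class w' A"
  shows "g_map w = g_map w'"
  using assms by (simp add: g_map_def)

lemma g_map_shift:
  assumes "gauss_word (A # r)"
  shows "g_map (A # r) = g_map (r @ [A])"
  using u_class_rotate1[OF assms] t_class_rotate1[OF assms] by (intro g_map_cong) auto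

lemma g_map_H1:
  assumes "gauss_word (x @ [A, A] @ y)" "gauss_word (x @ y)"
  shows "g_map (x @ [A, A] @ y) = g_map (x @ y)"
proof -
  let ?w = "x @ [A, A] @ y"
  have "g_map ?w = (\<Sum>D\<in>insert A (set (x @ y)). frag_of (u_class ?w D) - frag_of (t_class ?w))"
    by (simp add: g_map_def)
  also have "\<dots> = (\<Sum>D\<in>set (x @ y). frag_of (u_class ?w D) - frag_of (t_class ?w))"
    using gauss_word_H1_fresh[OF assms(1)] u_class_H1_self[OF assms(1)] t_class_H1[OF assms]
    by (subst sum.insert) simp_all
  also have "\<dots> = g_map (x @ y)"
    unfolding g_map_def using u_class_H1_other[OF assms] t_class_H1[OF assms]
    by (intro sum.cong) simp_all
  finally show ?thesis .
qed

text \<open>Here \<open>c\<close> is the common contribution of the two deleted letters.\<close>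

lemma g_map_H2:
  assumes g: "gauss_word (x @ [A, B] @ y @ [B, A] @ z)" "gauss_word (x @ y @ z)" and AB: "A \<noteq> B"
  shows "\<exists>c \<in> carrier G_grp. g_map (x @ [A, B] @ y @ [B, A] @ z) = (c + c) + g_map (x @ y @ z)"
proof -
  let ?w = "x @ [A, B] @ y @ [B, A] @ z"
  define c where "c = frag_of (u_class ?w A) - frag_of (t_class ?w)"
  have "u_class ?w A \<in> GP 2" "t_class ?w \<in> GP 2"
    unfolding u_class_def t_class_def
    using g(1) by (auto intro!: GP_class_in_GP gauss_phrase_p gauss_phrase_t)
  then have c: "c \<in> carrier G_grp"
    using keys_diff[of "frag_of (u_class ?w A)" "frag_of (t_class ?w)"]
    by (auto simp: G_grp_def c_def)
  have "g_map ?w = (\<Sum>D\<in>insert A (insert B (set (x @ y @ z))). frag_of (u_class ?w D) - frag_of (t_class ?w))"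
    unfolding g_map_def by (intro sum.cong) auto
  also have "\<dots> = (c + c) + (\<Sum>D\<in>set (x @ y @ z). frag_of (u_class ?w D) - frag_of (t_class ?w))"
    using gauss_word_H2_fresh[OF g(1) AB] AB u_class_H2_self[OF g(1) AB]
    by (simp add: c_def add.assoc)
  also have "(\<Sum>D\<in>set (x @ y @ z). frag_of (u_class ?w D) - frag_of (t_class ?w)) = g_map (x @ y @ z)"
    unfolding g_map_def using u_class_H2_other[OF g AB] t_class_H2[OF g AB]
    by (intro sum.cong) simp_all
  finally show ?thesis
    using c by blast
qed

lemma g_map_H3:
  fixes A B C :: "'a::infinite"
  assumes "gauss_word (x @ [A, B] @ y @ [A, C] @ z @ [B, C] @ t)"
    "gauss_word (x @ [B, A] @ y @ [C, A] @ z @ [C, B] @ t)" "distinct [A, B, C]"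
  shows "g_map (x @ [A, B] @ y @ [A, C] @ z @ [B, C] @ t) =
         g_map (x @ [B, A] @ y @ [C, A] @ z @ [C, B] @ t)" (is "g_map ?w = g_map ?w'")
proof (rule g_map_cong)
  show "set ?w = set ?w'" by auto
  show "t_class ?w = t_class ?w'" by (rule t_class_H3[OF assms])
  fix D assume "D \<in> set ?w"
  then consider "D \<in> set (x @ y @ z @ t)" | "D = A" | "D = B" | "D = C" by auto
  then show "u_class ?w D = u_class ?w' D"
    using u_class_H3_other[OF assms] u_class_H3_self_A[OF assms] u_class_H3_self_B[OF assms]
      u_class_H3_self_C[OF assms] by cases blast+
qed

lemma theta_add_double:
  assumes "c \<in> carrier G_grp" "g \<in> carrier G_grp"
  shows "theta ((c + c) + g) = theta g"
proof -
  interpret comm_group G_grp by (rule comm_group_G)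
  have add: "a \<otimes>\<^bsub>G_grp\<^esub> b = a + b" for a b
    by (simp add: G_grp_def)
  have cc: "c + c \<in> twoG" "c + c \<in> carrier G_grp"
    using assms(1) m_closed[of c c] by (auto simp: twoG_def add)
  have "theta ((c + c) + g) = (twoG #>\<^bsub>G_grp\<^esub> (c + c)) #>\<^bsub>G_grp\<^esub> g"
    unfolding theta_def using coset_mult_assoc[OF subgroup.subset[OF subgroup_twoG] cc(2) assms(2)] by (simp add: add)
  also have "twoG #>\<^bsub>G_grp\<^esub> (c + c) = twoG"
    using coset_join2 cc subgroup_twoG by blast
  finally show ?thesis
    by (simp add: theta_def)
qed

lemma z_map_move:
  fixes w w' :: "'a::infinite list"
  assumes "word_move w w'" "gauss_word w" "gauss_word w'"
  shows "z_map w = z_map w'"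
  using assms
proof cases
  case (Shift A x y)
  then show ?thesis
    using g_map_shift[of A "x @ [A] @ y"] assms(2) by (simp add: z_map_def)
next
  case (H1 x A y)
  then show ?thesis
    using g_map_H1[of x A y] assms(2,3) by (simp add: z_map_def)
next
  case (H2 A B x y z)
  then obtain c where "c \<in> carrier G_grp" "g_map w = (c + c) + g_map w'"
    using g_map_H2[of x A B y z] assms(2,3) by auto
  then show ?thesis
    using theta_add_double g_map_in_G[OF assms(3)] by (simp add: z_map_def)
next
  case (H3 A B C x y z t)
  then show ?thesis
    using g_map_H3[of x A B y C z t] assms(2,3) by (simp add: z_map_def)
qed

lemma z_map_iso:
  assumes "word_iso w w'" "gauss_word w"
  shows "z_map w = z_map w'"
proof -
  obtain f where f: "bij_betw f (set w) (set w')" "w' = map f w"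
    using assms(1) unfolding word_iso_def by blast
  have inj: "inj_on f (set w)"
    using f(1) by (rule bij_betw_imp_inj_on)
  have g': "gauss_word (map f w)"
    by (rule gauss_word_map[OF assms(2) inj])
  have t: "t_class w = t_class w'"
    using phrase_sim_map[OF gauss_phrase_t[OF assms(2)], of f] inj GP_class_eqI
    by (simp add: t_class_def f(2))
  have u: "u_class w A = u_class w' (f A)" if A: "A \<in> set w" for A
  proof -
    obtain x y z where w: "w = x @ [A] @ y @ [A] @ z"
      using gauss_word_split[OF assms(2) A] .
    have "[y, x @ z] \<sim>\<^sub>p map (map f) [y, x @ z]"
      using assms(2) gauss_phrase_split[of x A y z] inj
      by (intro phrase_sim_map) (auto simp: w intro: inj_on_subset)
    then show ?thesis
      using u_class_split[of x A y z] u_class_split[of "map f x" "f A" "map f y" "map f z"]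
        assms(2) g' GP_class_eqI by (simp add: f(2) w)
  qed
  have "g_map w = g_map w'"
    unfolding g_map_def using sum.reindex_bij_betw[OF f(1)] u t by (simp flip: sum.reindex_bij_betw[OF f(1)])
  then show ?thesis
    by (simp add: z_map_def)
qed

theorem theorem4p1:
  fixes w1 w2 :: "'a::infinite list"
  assumes "gauss_word w1" and "gauss_word w2"
    and "homotopic_words w1 w2"
  shows "z_map w1 = z_map w2"
proof -
  have "word_step\<^sup>*\<^sup>* w1 w2"
    using assms(3) by (simp add: homotopic_words_def)
  then show ?thesis
  proof (induction rule: rtranclp_induct)
    case (step v w)
    then have "z_map v = z_map w"
      unfolding word_step_def using z_map_iso z_map_move by metis
    with step.IH show ?case by simp
  qed simp
qed

end
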